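(* Let $R$ be a finite non-commutative ring. Then the number of edges of the non-commuting graph $\Gamma_R$ is \[ |E(\Gamma_R)| = \frac{|R|^2}{2}\bigl(1-\Pr(R)\bigr). \]
   Context: Rings are associative and not assumed to have a unity. For a ring $R$, $Z(R)=\{x\in R : xr=rx \text{ for all } r\in R\}$ is its center. The non-commuting graph $\Gamma_R$ of a finite ring $R$ is the simple undirected graph with vertex set $R\setminus Z(R)$ in which two distinct vertices $a,b$ are adjacent if and only if $ab\neq ba$; $E(\Gamma_R)$ is its set of (undirected) edges. The commuting probability of a finite ring $R$ is $\Pr(R)=\dfrac{|\{(a,b)\in R\times R : ab=ba\}|}{|R|^2}$. *)

theory Defs
  imports Complex_Main "HOL-Library.Cardinality"
begin

text \<open>
  A ring is a type of class \<^class>\<open>ring\<close>, which requires associativity but no unity.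
\<close>

definition ring_center :: "'a::ring set" where
  "ring_center = {x. \<forall>r. x * r = r * x}"

text \<open>Undirected edges are unordered pairs, represented as two-element sets of vertices.\<close>

record 'a simple_graph =
  vertices :: "'a set"
  edges :: "'a set set"

definition non_commuting_graph :: "'a::ring simple_graph" where
  "non_commuting_graph =
    \<lparr> vertices = UNIV - ring_center,
      edges = {{a, b} | a b. a \<in> UNIV - ring_center \<and> b \<in> UNIV - ring_center
                \<and> a \<noteq> b \<and> a * b \<noteq> b * a} \<rparr>"

lemma non_commuting_graph_simple:
  assumes "e \<in> edges non_commuting_graph"
  shows "e \<subseteq> vertices non_commuting_graph" and "card e = 2"
  using assms by (auto simp: non_commuting_graph_def)

definition commuting_probability :: "'a::{ring,finite} itself \<Rightarrow> real" where
  "commuting_probability _ =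
    real (card {(a, b). (a::'a) * b = b * a}) / (real CARD('a))\<^sup>2"

end

theory Submission
  imports Defs
begin

text \<open>
  The pairs in \<open>R \<times> R\<close> that do not commute are the complement of those counted by the commuting
  probability, so there are \<open>|R|\<^sup>2 (1 - Pr(R))\<close> of them. Non-commutation is symmetric and
  irreflexive, so each unordered non-commuting pair arises from exactly two ordered ones
  (\<open>card_sym_irrefl\<close>). Finally, every such unordered pair is an edge: an element that fails to
  commute with something is outside the center (\<open>edges_eq_image\<close>).
\<close>

text \<open>
  Forgetting the order of a pair is a map that is exactly two-to-one on a symmetric irreflexive
  relation: symmetry puts both orders into the relation, and irreflexivity keeps them distinct.
\<close>

lemma card_sym_irrefl:
  assumes "finite r" "sym r" "irrefl r"
  shows "card r = 2 * card ((\<lambda>(a, b). {a, b}) ` r)"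
proof -
  let ?g = "\<lambda>(a, b). {a, b}"
  have fibre: "card {p \<in> r. ?g p = e} = 2" if "e \<in> ?g ` r" for e
  proof -
    obtain p where "p \<in> r" "e = ?g p"
      using \<open>e \<in> ?g ` r\<close> by blast
    then obtain a b where ab: "(a, b) \<in> r" "e = {a, b}"
      by (cases p) simp
    have "a \<noteq> b" "(b, a) \<in> r"
      using ab assms by (auto simp: irrefl_def dest: symD)
    then have "{p \<in> r. ?g p = e} = {(a, b), (b, a)}"
      using ab by (auto simp: doubleton_eq_iff)
    then show ?thesis
      using \<open>a \<noteq> b\<close> by simp
  qed
  have "card r = (\<Sum>e\<in>?g ` r. card {p \<in> r. ?g p = e})"
    using sum.image_gen[OF assms(1), of "\<lambda>_. 1::nat" ?g] by simp
  also have "\<dots> = (\<Sum>e\<in>?g ` r. 2)"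
    by (rule sum.cong) (simp_all add: fibre)
  finally show ?thesis
    by simp
qed

lemma edges_eq_image:
  "edges (non_commuting_graph :: 'a::ring simple_graph)
    = (\<lambda>(a, b). {a, b}) ` {(a, b). a * b \<noteq> b * a}"
proof -
  have "a \<notin> ring_center \<and> b \<notin> ring_center \<and> a \<noteq> b" if "a * b \<noteq> b * a" for a b :: 'a
    using that unfolding ring_center_def mem_Collect_eq by metis
  then have "edges (non_commuting_graph :: 'a simple_graph) = {{a, b} | a b. a * b \<noteq> b * a}"
    unfolding non_commuting_graph_def simple_graph.simps by blast
  also have "\<dots> = (\<lambda>(a, b). {a, b}) ` {(a, b). a * b \<noteq> b * a}"
    by auto
  finally show ?thesis .
qed

theorem theorem3p1:
  assumes "\<exists>a b :: 'a::{ring,finite}. a * b \<noteq> b * a"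
  shows "real (card (edges (non_commuting_graph :: 'a simple_graph)))
    = (real CARD('a))\<^sup>2 / 2 * (1 - commuting_probability TYPE('a))"
proof -
  let ?C = "{(a, b). (a::'a) * b = b * a}" and ?N = "{(a, b). (a::'a) * b \<noteq> b * a}"
  have "card ?N = 2 * card (edges (non_commuting_graph :: 'a simple_graph))"
    unfolding edges_eq_image by (rule card_sym_irrefl) (auto simp: sym_def irrefl_def)
  moreover have "card ?C + card ?N = (CARD('a))\<^sup>2"
  proof -
    have "card ?C + card ?N = card (?C \<union> ?N)"
      by (rule card_Un_disjoint[symmetric]) auto
    also have "?C \<union> ?N = UNIV \<times> UNIV"
      by auto
    finally show ?thesis
      by (simp only: card_cartesian_product power2_eq_square)
  qed
  ultimately have "real (card ?C + 2 * card (edges (non_commuting_graph :: 'a simple_graph)))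
      = real ((CARD('a))\<^sup>2)"
    by (simp only:)
  then have "2 * real (card (edges (non_commuting_graph :: 'a simple_graph)))
      = (real CARD('a))\<^sup>2 - real (card ?C)"
    by (simp only: of_nat_add of_nat_mult of_nat_numeral of_nat_power eq_diff_eq add.commute)
  then show ?thesis
    unfolding commuting_probability_def by (simp add: right_diff_distrib)
qed

end
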